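(* For a scalar type spectral operator $A$ in a complex Banach space $(X,\|\cdot\|)$ with spectral measure $E_A$, one has (i) $\displaystyle \mathcal{E}^{\{0\}}(A)=\bigcup_{\alpha>0}E_A(\Delta_\alpha)X$; (ii) $\displaystyle \mathcal{E}^{(0)}(A)=\bigcap_{\alpha>0}E_A(\Delta_\alpha)X=E_A(\{0\})X=\ker A:=\{f\in X : Af=0\}$, where $\Delta_\alpha:=\{\lambda\in\mathbb{C} : |\lambda|\le\alpha\}$, $\alpha>0$.
   Context: $\mathbb{Z}_+=\{0,1,2,\dots\}$, $\mathbb{N}=\{1,2,3,\dots\}$; $D(\cdot)$ denotes the domain of an operator; in $\ker A$ it is understood that $f\in D(A)$. $E_A(\delta)X$ denotes the range of $E_A(\delta)$. Scalar type spectral operators. Let $X$ be a complex Banach space. A spectral measure $E$ on $X$ assigns to each Borel set $\delta\subseteq\mathbb{C}$ a bounded projection $E(\delta)$ on $X$, is strongly countably additive, and satisfies $E(\mathbb{C})=I$ and $E(\delta\cap\sigma)=E(\delta)E(\sigma)$. Such $E$ is uniformly bounded, and for a bounded Borel function $G:\mathbb{C}\to\mathbb{C}$ the integral $\int_{\mathbb{C}} G\,dE$ is the bounded operator obtained as the operator-norm limit of the integrals of simple Borel functions converging uniformly to $G$. For an arbitrary Borel measurable $G:\mathbb{C}\to\mathbb{C}$ put $G_n:=G\,\chi_{\{\lambda\,:\,|G(\lambda)|\le n\}}$, $n\in\mathbb{N}$, and define the operator $\int_{\mathbb{C}} G\,dE$ by $$\Big(\int_{\mathbb{C}} G\,dE\Big)f:=\lim_{n\to\infty}\Big(\int_{\mathbb{C}}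 G_n\,dE\Big)f$$ with domain the set of all $f\in X$ for which this limit exists. A (possibly unbounded, densely defined, closed) linear operator $A$ in $X$ is a scalar type spectral operator if there is a spectral measure $E_A$ with $A=\int_{\mathbb{C}}\lambda\,dE_A(\lambda)$ (equality including domains). Then $E_A$ is unique, is called the spectral measure (resolution of the identity) of $A$, and is supported on the spectrum $\sigma(A)$. Entire vectors of exponential type and of minimal exponential type. $C^\infty(A):=\bigcap_{n=0}^\infty D(A^n)$, and $$\mathcal{E}^{\{0\}}(A):=\{f\in C^\infty(A): \exists\alpha>0\ \exists c>0:\ \|A^nf\|\le c\,\alpha^n,\ n\in\mathbb{Z}_+\},$$ $$\mathcal{E}^{(0)}(A):=\{f\in C^\infty(A): \forall\alpha>0\ \exists c>0:\ \|A^nf\|\le c\,\alpha^n,\ n\in\mathbb{Z}_+\}.$$ *)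

theory Defs
  imports "HOL-Analysis.Analysis"
begin

section \<open>Complex Banach spaces\<close>

class complex_normed_vector = real_normed_vector +
  fixes scaleC :: "complex \<Rightarrow> 'a \<Rightarrow> 'a" (infixr "*\<^sub>C" 75)
  assumes scaleC_add_right: "a *\<^sub>C (x + y) = a *\<^sub>C x + a *\<^sub>C y"
    and scaleC_add_left: "(a + b) *\<^sub>C x = a *\<^sub>C x + b *\<^sub>C x"
    and scaleC_scaleC: "a *\<^sub>C b *\<^sub>C x = (a * b) *\<^sub>C x"
    and scaleC_one: "1 *\<^sub>C x = x"
    and scaleC_of_real: "complex_of_real r *\<^sub>C x = r *\<^sub>R x"
    and norm_scaleC: "norm (a *\<^sub>C x) = cmod a * norm x"

class complex_banach = complex_normed_vector + banach

instantiation complex :: complex_banach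
begin

definition scaleC_complex :: "complex \<Rightarrow> complex \<Rightarrow> complex" where
  "scaleC_complex a x = a * x"

instance
  by standard (auto simp: scaleC_complex_def algebra_simps norm_mult scaleR_conv_of_real)

end

lemma bounded_linear_scaleC: "bounded_linear (\<lambda>x :: 'a :: complex_normed_vector. a *\<^sub>C x)"
proof (rule bounded_linear_intro[where K = "cmod a"])
  fix r :: real and x y :: 'a
  show "a *\<^sub>C (x + y) = a *\<^sub>C x + a *\<^sub>C y"
    by (rule scaleC_add_right)
  show "a *\<^sub>C (r *\<^sub>R x) = r *\<^sub>R (a *\<^sub>C x)"
    by (simp flip: scaleC_of_real add: scaleC_scaleC mult.commute)
  show "norm (a *\<^sub>C x) \<le> norm x * cmod a"
    by (simp add: norm_scaleC mult.commute)
qed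

definition scaleC_blinfun :: "complex \<Rightarrow> 'a \<Rightarrow>\<^sub>L 'a :: complex_normed_vector" where
  "scaleC_blinfun a = Blinfun (\<lambda>x. a *\<^sub>C x)"

lemma scaleC_blinfun_apply [simp]: "blinfun_apply (scaleC_blinfun a) x = a *\<^sub>C x"
  by (simp add: scaleC_blinfun_def bounded_linear_Blinfun_apply bounded_linear_scaleC)


section \<open>Unbounded operators\<close>

text \<open>
  An operator in \<open>X\<close> is a partial map \<open>A :: 'a \<rightharpoonup> 'a\<close> with domain \<^term>\<open>dom A\<close>, so that
  equality of partial maps is equality of operators including their domains.
\<close>

definition linear_operator :: "('a :: complex_normed_vector \<rightharpoonup> 'a) \<Rightarrow> bool" where
  "linear_operator A \<longleftrightarrow>
     A 0 = Some 0 \<and>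
     (\<forall>x y u v. A x = Some u \<longrightarrow> A y = Some v \<longrightarrow> A (x + y) = Some (u + v)) \<and>
     (\<forall>a x u. A x = Some u \<longrightarrow> A (a *\<^sub>C x) = Some (a *\<^sub>C u))"

definition densely_defined :: "('a :: complex_normed_vector \<rightharpoonup> 'a) \<Rightarrow> bool" where
  "densely_defined A \<longleftrightarrow> closure (dom A) = UNIV"

definition closed_operator :: "('a :: complex_normed_vector \<rightharpoonup> 'a) \<Rightarrow> bool" where
  "closed_operator A \<longleftrightarrow> closed (Map.graph A)"

primrec op_power :: "('a \<rightharpoonup> 'a) \<Rightarrow> nat \<Rightarrow> ('a \<rightharpoonup> 'a)" where
  "op_power A 0 = Some"
| "op_power A (Suc n) = A \<circ>\<^sub>m op_power A n"

definition op_ker :: "('a :: complex_normed_vector \<rightharpoonup> 'a) \<Rightarrow> 'a set" where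
  "op_ker A = {f \<in> dom A. the (A f) = 0}"

definition C_infinity :: "('a \<rightharpoonup> 'a) \<Rightarrow> 'a set" where
  "C_infinity A = (\<Inter>n. dom (op_power A n))"


section \<open>Entire vectors of exponential and of minimal exponential type\<close>

definition exp_type_vectors :: "('a :: complex_normed_vector \<rightharpoonup> 'a) \<Rightarrow> 'a set" where
  "exp_type_vectors A =
     {f \<in> C_infinity A. \<exists>\<alpha>>0. \<exists>c>0. \<forall>n. norm (the (op_power A n f)) \<le> c * \<alpha> ^ n}"

definition min_exp_type_vectors :: "('a :: complex_normed_vector \<rightharpoonup> 'a) \<Rightarrow> 'a set" where
  "min_exp_type_vectors A =
     {f \<in> C_infinity A. \<forall>\<alpha>>0. \<exists>c>0. \<forall>n. norm (the (op_power A n f)) \<le> c * \<alpha> ^ n}"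


section \<open>Spectral measures and scalar type spectral operators\<close>

text \<open>
  The type \<open>'a \<Rightarrow>\<^sub>L 'a\<close> only provides real linearity, hence the explicit homogeneity condition.
  Values of \<open>E\<close> on non-Borel sets are unconstrained and never used.
\<close>

definition spectral_measure :: "(complex set \<Rightarrow> 'a \<Rightarrow>\<^sub>L 'a :: complex_banach) \<Rightarrow> bool" where
  "spectral_measure E \<longleftrightarrow>
     (\<forall>\<delta>\<in>sets borel. (\<forall>a x. E \<delta> (a *\<^sub>C x) = a *\<^sub>C E \<delta> x) \<and> E \<delta> o\<^sub>L E \<delta> = E \<delta>) \<and>
     (\<forall>\<delta> :: nat \<Rightarrow> complex set. range \<delta> \<subseteq> sets borel \<longrightarrow> disjoint_family \<delta> \<longrightarrow>
        (\<forall>f. (\<lambda>n. E (\<delta> n) f) sums E (\<Union>n. \<delta> n) f)) \<and>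
     E UNIV = id_blinfun \<and>
     (\<forall>\<delta>\<in>sets borel. \<forall>\<sigma>\<in>sets borel. E (\<delta> \<inter> \<sigma>) = E \<delta> o\<^sub>L E \<sigma>)"

definition simple_integral_op ::
    "(complex set \<Rightarrow> 'a \<Rightarrow>\<^sub>L 'a :: complex_banach) \<Rightarrow> (complex \<Rightarrow> complex) \<Rightarrow> 'a \<Rightarrow>\<^sub>L 'a" where
  "simple_integral_op E G = (\<Sum>w\<in>range G. scaleC_blinfun w o\<^sub>L E (G -` {w}))"

text \<open>
  For bounded Borel \<open>G\<close>; the limit of the integrals is taken in the operator norm,
  which is the norm of \<open>'a \<Rightarrow>\<^sub>L 'a\<close>.
\<close>

definition bounded_integral_op ::
    "(complex set \<Rightarrow> 'a \<Rightarrow>\<^sub>L 'a :: complex_banach) \<Rightarrow> (complex \<Rightarrow> complex) \<Rightarrow> 'a \<Rightarrow>\<^sub>L 'a" where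
  "bounded_integral_op E G =
     (THE T. \<exists>s :: nat \<Rightarrow> complex \<Rightarrow> complex.
        (\<forall>n. simple_function borel (s n)) \<and> uniform_limit UNIV s G sequentially \<and>
        (\<lambda>n. simple_integral_op E (s n)) \<longlonglongrightarrow> T)"

definition truncation :: "(complex \<Rightarrow> complex) \<Rightarrow> nat \<Rightarrow> complex \<Rightarrow> complex" where
  "truncation G n z = (if cmod (G z) \<le> real n then G z else 0)"

definition spectral_integral ::
    "(complex set \<Rightarrow> 'a \<Rightarrow>\<^sub>L 'a :: complex_banach) \<Rightarrow> (complex \<Rightarrow> complex) \<Rightarrow> ('a \<rightharpoonup> 'a)" where
  "spectral_integral E G f =
     (if convergent (\<lambda>n. bounded_integral_op E (truncation G n) f)
      then Some (lim (\<lambda>n. bounded_integral_op E (truncation G n) f))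
      else None)"

definition is_spectral_measure_of ::
    "(complex set \<Rightarrow> 'a \<Rightarrow>\<^sub>L 'a :: complex_banach) \<Rightarrow> ('a \<rightharpoonup> 'a) \<Rightarrow> bool" where
  "is_spectral_measure_of E A \<longleftrightarrow> spectral_measure E \<and> A = spectral_integral E (\<lambda>z. z)"

definition scalar_type_spectral :: "('a :: complex_banach \<rightharpoonup> 'a) \<Rightarrow> bool" where
  "scalar_type_spectral A \<longleftrightarrow>
     linear_operator A \<and> densely_defined A \<and> closed_operator A \<and>
     (\<exists>E. is_spectral_measure_of E A)"

definition closed_disc :: "real \<Rightarrow> complex set" ("\<Delta>") where
  "\<Delta> \<alpha> = {z. cmod z \<le> \<alpha>}"

end

theory Submission
  imports Defs
begin

text \<open>
  A spectral measure is uniformly bounded: countable additivity bounds \<open>\<delta> \<mapsto> E \<delta> f\<close> for each \<open>f\<close>,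
  and the uniform boundedness principle applies. Hence the integral is a bounded multiplicative
  functional calculus. If \<open>f = E (\<Delta> \<alpha>) f\<close>, then \<open>A\<^sup>k f\<close> is the integral of
  \<open>\<lambda>\<^sup>k\<close> over \<open>\<Delta> \<alpha>\<close> applied to \<open>f\<close>, of norm at most \<open>C \<alpha>\<^sup>k \<parallel>f\<parallel>\<close>, where \<open>C\<close>
  does not depend on \<open>\<alpha>\<close>. Conversely, if \<open>\<parallel>A\<^sup>k f\<parallel> \<le> c \<alpha>\<^sup>k\<close>, then on a bounded part \<open>\<sigma>\<close> of
  \<open>{2 \<alpha> < |\<lambda>|}\<close> one can divide by \<open>\<lambda>\<^sup>k\<close>, which gives \<open>\<parallel>E \<sigma> f\<parallel> = O(2\<^sup>-\<^sup>k)\<close>, hence \<open>E \<sigma> f = 0\<close>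
  and \<open>f = E (\<Delta> (2 \<alpha>)) f\<close>. A vector of the kernel is trivially of minimal exponential type.
\<close>


section \<open>Uniform boundedness\<close>

text \<open>Baire category: the closed sets \<open>C n\<close> cover the complete space, so one of
  them contains a ball, and a common bound on a ball bounds the operator norms.\<close>

lemma uniform_boundedness:
  fixes F :: "('a :: banach \<Rightarrow>\<^sub>L 'b :: real_normed_vector) set"
  assumes pointwise: "\<And>x. \<exists>K. \<forall>T\<in>F. norm (T x) \<le> K"
  shows "\<exists>K. \<forall>T\<in>F. norm T \<le> K"
proof -
  define C where "C n = {x. \<forall>T\<in>F. norm (T x) \<le> real n}" for n :: nat
  have "C n = (\<Inter>T\<in>F. {x. norm (blinfun_apply T x) \<le> real n})" for n
    by (auto simp: C_def)
  then have closed_C: "closed (C n)" for n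
    by (auto intro!: closed_INT closed_Collect_le continuous_intros)
  have "\<exists>n. interior (C n) \<noteq> {}"
  proof (rule ccontr)
    assume "\<not> ?thesis"
    then have "euclidean interior_of \<Union>(range C) = {}"
      by (intro Baire_category_alt disjI1 completely_metrizable_space_euclidean)
        (auto simp: closed_C euclidean_interior_of)
    moreover have "\<Union>(range C) = UNIV"
    proof -
      have "\<exists>n. x \<in> C n" for x
      proof -
        obtain K where K: "\<forall>T\<in>F. norm (T x) \<le> K" using pointwise by blast
        obtain n :: nat where "K \<le> real n" using real_arch_simple by blast
        then show ?thesis using K unfolding C_def by (blast intro: order_trans)
      qed
      then show ?thesis by blast
    qed
    ultimately show False by (simp add: euclidean_interior_of)
  qed
  then obtain n x where "x \<in> interior (C n)" by blast
  then obtain r where r: "r > 0" "cball x r \<subseteq> C n"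
    by (meson mem_interior_cball)
  have "norm T \<le> 2 * real n / r" if "T \<in> F" for T
  proof (rule norm_blinfun_bound)
    show "0 \<le> 2 * real n / r" using r by simp
    fix y
    show "norm (T y) \<le> 2 * real n / r * norm y"
    proof (cases "y = 0")
      case False
      \<comment> \<open>Rescaling \<open>y\<close> to length \<open>r\<close> keeps
        \<open>x + t *\<^sub>R y\<close> in the ball, so \<open>T (t *\<^sub>R y)\<close> is a
        difference of two values of norm at most \<open>n\<close>.\<close>
      define t where "t = r / norm y"
      have t: "t > 0" using False r by (simp add: t_def)
      have "x + t *\<^sub>R y \<in> cball x r" "x \<in> cball x r"
        using False r by (auto simp: dist_norm t_def)
      then have *: "norm (T (x + t *\<^sub>R y)) \<le> n" "norm (T x) \<le> n"
        using r(2) that unfolding C_def by blast+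
      have "t * norm (T y) = norm (T (x + t *\<^sub>R y) - T x)"
        using t by (simp add: blinfun.bilinear_simps)
      also have "\<dots> \<le> 2 * real n" using norm_triangle_ineq4[of "T (x + t *\<^sub>R y)" "T x"] * by linarith
      finally show ?thesis using t False r by (simp add: t_def field_simps)
    qed (simp add: blinfun.zero_right)
  qed
  then show ?thesis by blast
qed

lemma countably_additive_bounded:
  fixes \<mu> :: "'a set \<Rightarrow> 'b :: real_normed_vector"
  assumes ca: "\<And>\<delta> :: nat \<Rightarrow> 'a set. range \<delta> \<subseteq> sets M \<Longrightarrow> disjoint_family \<delta> \<Longrightarrow>
      (\<lambda>n. \<mu> (\<delta> n)) sums \<mu> (\<Union>n. \<delta> n)"
    and add: "\<And>A B. A \<in> sets M \<Longrightarrow> B \<in> sets M \<Longrightarrow> \<mu> A = \<mu> (A \<inter> B) + \<mu> (A - B)"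
  shows "\<exists>K. \<forall>\<delta>\<in>sets M. norm (\<mu> \<delta>) \<le> K"
proof (rule ccontr)
  assume unbounded: "\<not> ?thesis"
  \<comment> \<open>Splitting off a part of norm at least 1 from a set with unbounded subsets, so that unbounded
    subsets remain, yields disjoint sets violating summability.\<close>
  define unb where "unb A \<longleftrightarrow> A \<in> sets M \<and> (\<forall>K. \<exists>B\<in>sets M. B \<subseteq> A \<and> norm (\<mu> B) > K)" for A
  have step: "\<exists>B. unb B \<and> B \<subseteq> A \<and> norm (\<mu> (A - B)) \<ge> 1" if "unb A" for A
  proof -
    have A: "A \<in> sets M" using that by (simp add: unb_def)
    \<comment> \<open>The excess 1 over the norm of \<open>\<mu> A\<close> makes both
      \<open>C\<close> and \<open>A - C\<close> large, so either piece may be split off.\<close>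
    obtain C where C: "C \<in> sets M" "C \<subseteq> A" "norm (\<mu> C) > norm (\<mu> A) + 1"
      using \<open>unb A\<close> unfolding unb_def by blast
    have "\<mu> A = \<mu> C + \<mu> (A - C)"
      using add[OF A C(1)] C(2) by (simp add: Int_absorb1)
    then have "norm (\<mu> (A - C)) = norm (\<mu> C - \<mu> A)"
      by (simp add: norm_minus_commute)
    then have large: "norm (\<mu> (A - C)) \<ge> 1" "norm (\<mu> (A - (A - C))) \<ge> 1"
      using norm_triangle_ineq2[of "\<mu> C" "\<mu> A"] C norm_ge_zero[of "\<mu> A"]
      by (auto simp: double_diff simp del: norm_ge_zero)
    \<comment> \<open>Bounds \<open>K\<close> and \<open>L\<close> for the parts of the two pieces
      would bound every part of \<open>A\<close> by \<open>K + L\<close>.\<close>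
    have "unb C \<or> unb (A - C)"
    proof (rule ccontr)
      assume "\<not> ?thesis"
      then obtain K L where K: "\<And>B. B \<in> sets M \<Longrightarrow> B \<subseteq> C \<Longrightarrow> norm (\<mu> B) \<le> K"
        and L: "\<And>B. B \<in> sets M \<Longrightarrow> B \<subseteq> A - C \<Longrightarrow> norm (\<mu> B) \<le> L"
        using A C(1) unfolding unb_def by (metis linorder_not_le sets.Diff)
      obtain B where B: "B \<in> sets M" "B \<subseteq> A" "norm (\<mu> B) > K + L"
        using \<open>unb A\<close> unfolding unb_def by blast
      have "norm (\<mu> B) \<le> norm (\<mu> (B \<inter> C)) + norm (\<mu> (B - C))"
        using add[OF B(1) C(1)] by (simp add: norm_triangle_ineq)
      also have "\<dots> \<le> K + L"
        using B C by (intro add_mono K L) auto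
      finally show False using B(3) by simp
    qed
    then show ?thesis using large C(2) by blast
  qed
  have "unb (space M)"
    using unbounded sets.sets_into_space unfolding unb_def by (metis linorder_not_le sets.top)
  then obtain A where A: "\<And>n. unb (A n)" "\<And>n. A (Suc n) \<subseteq> A n \<and> norm (\<mu> (A n - A (Suc n))) \<ge> 1"
    using dependent_nat_choice[of "\<lambda>_. unb" "\<lambda>_ A B. B \<subseteq> A \<and> norm (\<mu> (A - B)) \<ge> 1"] step
    by metis
  define D where "D n = A n - A (Suc n)" for n
  have anti: "A n \<subseteq> A m" if "m \<le> n" for m n
    using lift_Suc_antimono_le[of A] A(2) that by blast
  have "disjoint_family D"
  proof -
    have "D m \<inter> D n = {}" if "m < n" for m n
      using anti[of "Suc m" n] that by (auto simp: D_def)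
    then show ?thesis
      unfolding disjoint_family_on_def by (metis Int_commute nat_neq_iff)
  qed
  moreover have "range D \<subseteq> sets M"
    using A(1) by (auto simp: D_def unb_def)
  ultimately have "(\<lambda>n. \<mu> (D n)) \<longlonglongrightarrow> 0"
    using ca sums_summable summable_LIMSEQ_zero by blast
  then obtain N where "norm (\<mu> (D N)) < 1"
    by (auto dest!: LIMSEQ_D[where r = 1])
  then show False using A(2)[of N] by (simp add: D_def)
qed


section \<open>Norms of linear combinations\<close>

text \<open>The vector is affine in each coefficient, hence a convex combination of its values at
  coefficients 0 and 1, which are subset sums shifted by \<open>u\<close>. The shift is arbitrary
  because in the induction it takes up \<open>v i\<close>.\<close>

lemma norm_convex_combination_le:
  fixes v :: "'i \<Rightarrow> 'a :: real_normed_vector"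
  assumes "finite I" "\<And>i. i \<in> I \<Longrightarrow> 0 \<le> c i \<and> c i \<le> 1"
    and "\<And>S. S \<subseteq> I \<Longrightarrow> norm (u + sum v S) \<le> K"
  shows "norm (u + (\<Sum>i\<in>I. c i *\<^sub>R v i)) \<le> K"
  using assms
proof (induction I arbitrary: u rule: finite_induct)
  case empty
  then show ?case by force
next
  case (insert i I)
  let ?s = "\<Sum>i\<in>I. c i *\<^sub>R v i"
  have 1: "norm (u + ?s) \<le> K"
    by (rule insert.IH) (simp_all add: insert.prems subset_insertI2)
  have 2: "norm ((u + v i) + ?s) \<le> K"
  proof (rule insert.IH, goal_cases)
    case (2 S)
    then have "i \<notin> S" "finite S"
      using insert.hyps finite_subset by auto
    then show ?case
      using insert.prems(2)[of "insert i S"] insert_mono[OF 2, of i] by (simp add: add.assoc)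
  qed (use insert in auto)
  have c: "0 \<le> c i" "c i \<le> 1" using insert.prems(1) by auto
  have "u + (\<Sum>i\<in>insert i I. c i *\<^sub>R v i) = (1 - c i) *\<^sub>R (u + ?s) + c i *\<^sub>R ((u + v i) + ?s)"
    using insert.hyps by (simp add: algebra_simps)
  also have "norm \<dots> \<le> (1 - c i) * norm (u + ?s) + c i * norm ((u + v i) + ?s)"
    using c by (intro norm_triangle_le) simp
  also have "\<dots> \<le> (1 - c i) * K + c i * K"
    using c 1 2 by (intro add_mono mult_left_mono) auto
  finally show ?case by (simp add: algebra_simps)
qed

text \<open>An affine change of coefficients maps [-L, L] onto [0, 1]. Undoing it doubles one sum
  and subtracts the full sum, which gives the factor 2 + 1 = 3.\<close>

lemma norm_sum_scaleR_le:
  fixes v :: "'i \<Rightarrow> 'a :: real_normed_vector"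
  assumes "finite I" "L > 0" "\<And>i. i \<in> I \<Longrightarrow> \<bar>c i\<bar> \<le> L"
    and K: "\<And>S. S \<subseteq> I \<Longrightarrow> norm (sum v S) \<le> K"
  shows "norm (\<Sum>i\<in>I. c i *\<^sub>R v i) \<le> 3 * L * K"
proof -
  define d where "d i = (c i / L + 1) / 2" for i
  have d: "0 \<le> d i" "d i \<le> 1" if "i \<in> I" for i
    using assms(3)[OF that] \<open>L > 0\<close> by (auto simp: d_def field_simps)
  have "norm (0 + (\<Sum>i\<in>I. d i *\<^sub>R v i)) \<le> K"
    by (rule norm_convex_combination_le) (use assms d in auto)
  then have *: "norm (2 *\<^sub>R (\<Sum>i\<in>I. d i *\<^sub>R v i) - sum v I) \<le> 3 * K"
    using norm_triangle_ineq4[of "2 *\<^sub>R (\<Sum>i\<in>I. d i *\<^sub>R v i)" "sum v I"] K[of I] by simp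
  have "c = (\<lambda>i. L * (2 * d i - 1))"
    using \<open>L > 0\<close> by (simp add: d_def field_simps)
  then have "(\<Sum>i\<in>I. c i *\<^sub>R v i) = L *\<^sub>R (2 *\<^sub>R (\<Sum>i\<in>I. d i *\<^sub>R v i) - sum v I)"
    by (simp add: scaleR_sum_right sum_subtractf[symmetric] algebra_simps)
  then show ?thesis
    using mult_left_mono[OF *, of L] \<open>L > 0\<close> by simp
qed

section \<open>Complex scalars and complex coefficients\<close>

lemma scaleC_0_left [simp]: "0 *\<^sub>C (x :: 'a :: complex_normed_vector) = 0"
  using scaleC_of_real[of 0 x] by simp

lemma scaleC_0_right [simp]: "a *\<^sub>C (0 :: 'a :: complex_normed_vector) = 0"
  using scaleC_scaleC[of a 0 "0 :: 'a"] by simp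

lemma scaleC_conv_scaleR:
  "a *\<^sub>C (x :: 'a :: complex_normed_vector) = Re a *\<^sub>R x + \<i> *\<^sub>C (Im a *\<^sub>R x)"
proof -
  have "a *\<^sub>C x = (complex_of_real (Re a) + \<i> * complex_of_real (Im a)) *\<^sub>C x"
    by (simp only: complex_eq[symmetric])
  then show ?thesis
    by (simp add: scaleC_add_left scaleC_scaleC[symmetric] scaleC_of_real)
qed

lemma scaleC_sum_right:
  "a *\<^sub>C (\<Sum>i\<in>I. x i :: 'a :: complex_normed_vector) = (\<Sum>i\<in>I. a *\<^sub>C x i)"
  using linear_sum[OF bounded_linear.linear[OF bounded_linear_scaleC]] .

lemma scaleC_diff_left:
  "(a - b) *\<^sub>C (x :: 'a :: complex_normed_vector) = a *\<^sub>C x - b *\<^sub>C x"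
  using scaleC_add_left[of "a - b" b x] by (simp add: algebra_simps)

text \<open>Real and imaginary parts cost \<open>3 * L * K\<close> each. The bound does not depend
  on the number of terms, so it controls integrals of simple functions by the supremum of their
  values.\<close>

lemma norm_sum_scaleC_le:
  fixes v :: "'i \<Rightarrow> 'a :: complex_normed_vector"
  assumes "finite I" "L > 0" "\<And>i. i \<in> I \<Longrightarrow> cmod (c i) \<le> L"
    and K: "\<And>S. S \<subseteq> I \<Longrightarrow> norm (sum v S) \<le> K"
  shows "norm (\<Sum>i\<in>I. c i *\<^sub>C v i) \<le> 6 * L * K"
proof -
  have "(\<Sum>i\<in>I. c i *\<^sub>C v i) =
      (\<Sum>i\<in>I. Re (c i) *\<^sub>R v i) + \<i> *\<^sub>C (\<Sum>i\<in>I. Im (c i) *\<^sub>R v i)"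
    by (subst scaleC_conv_scaleR) (simp add: sum.distrib scaleC_sum_right)
  moreover have "norm (\<Sum>i\<in>I. Re (c i) *\<^sub>R v i) \<le> 3 * L * K"
    by (rule norm_sum_scaleR_le)
      (use assms order_trans[OF abs_Re_le_cmod] in auto)
  moreover have "norm (\<i> *\<^sub>C (\<Sum>i\<in>I. Im (c i) *\<^sub>R v i)) \<le> 3 * L * K"
    unfolding norm_scaleC norm_ii mult_1
    by (rule norm_sum_scaleR_le)
      (use assms order_trans[OF abs_Im_le_cmod] in auto)
  ultimately show ?thesis
    using norm_triangle_ineq[of "\<Sum>i\<in>I. Re (c i) *\<^sub>R v i"
      "\<i> *\<^sub>C (\<Sum>i\<in>I. Im (c i) *\<^sub>R v i)"] by simp
qed

text \<open>Real and imaginary parts are rounded down to multiples of 1/(n+1). The bound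
  \<open>K\<close> leaves only finitely many grid points, and the error is uniform in
  \<open>z\<close>.\<close>

lemma bounded_borel_uniform_approximation:
  fixes G :: "'b \<Rightarrow> complex"
  assumes [measurable]: "G \<in> borel_measurable M" and bd: "\<And>z. cmod (G z) \<le> K"
  obtains s where "\<And>n :: nat. simple_function M (s n)" "uniform_limit UNIV s G sequentially"
proof
  define q :: "nat \<Rightarrow> real \<Rightarrow> int" where "q n x = \<lfloor>real (Suc n) * x\<rfloor>" for n x
  define h where "h n p = Complex (of_int (fst p) / real (Suc n)) (of_int (snd p) / real (Suc n))"
    for n and p :: "int \<times> int"
  define s where "s n z = h n (q n (Re (G z)), q n (Im (G z)))" for n z
  have q_bound: "q n x \<in> {\<lfloor>- (real (Suc n) * K)\<rfloor>..\<lfloor>real (Suc n) * K\<rfloor>}" if "\<bar>x\<bar> \<le> K" for n x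
  proof -
    have "real (Suc n) * x \<le> real (Suc n) * K" "real (Suc n) * (- K) \<le> real (Suc n) * x"
      using that by (intro mult_left_mono; simp)+
    then show ?thesis unfolding q_def by (auto intro!: floor_mono)
  qed
  have q_approx: "\<bar>of_int (q n x) / real (Suc n) - x\<bar> \<le> 1 / real (Suc n)" for n x
  proof -
    have "\<bar>of_int (q n x) - real (Suc n) * x\<bar> \<le> 1"
      unfolding q_def by linarith
    moreover have "of_int (q n x) / real (Suc n) - x = (of_int (q n x) - real (Suc n) * x) / real (Suc n)"
      by (simp add: diff_divide_distrib)
    ultimately show ?thesis
      by (simp add: divide_right_mono)
  qed
  show "simple_function M (s n)" for n
  proof (rule simple_function_borel_measurable)
    show "s n \<in> borel_measurable M"
      unfolding s_def h_def q_def Complex_eq by simp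
    let ?I = "{\<lfloor>- (real (Suc n) * K)\<rfloor>..\<lfloor>real (Suc n) * K\<rfloor>}"
    have "s n ` space M \<subseteq> h n ` (?I \<times> ?I)"
      unfolding s_def
      by (intro image_subsetI imageI SigmaI q_bound order_trans[OF abs_Re_le_cmod bd]
          order_trans[OF abs_Im_le_cmod bd])
    then show "finite (s n ` space M)"
      by (rule finite_subset) (intro finite_imageI finite_cartesian_product finite_atLeastAtMost_int)
  qed
  have "dist (s n z) (G z) \<le> 2 / real (Suc n)" for n z
    using cmod_le[of "s n z - G z"] q_approx[of n "Re (G z)"] q_approx[of n "Im (G z)"]
    by (simp add: dist_norm s_def h_def)
  moreover have "(\<lambda>n. 2 / real (Suc n)) \<longlonglongrightarrow> 0"
    using tendsto_mult_left[OF LIMSEQ_inverse_real_of_nat, of 2] by (simp add: divide_inverse)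
  ultimately show "uniform_limit UNIV s G sequentially"
    by (auto simp: uniform_limit_iff elim!: eventually_mono[OF order_tendstoD(2)] intro: order_le_less_trans)
qed


section \<open>Integration of bounded Borel functions\<close>

context
  fixes E :: "complex set \<Rightarrow> 'a \<Rightarrow>\<^sub>L 'a :: complex_banach"
  assumes spectral: "spectral_measure E"
begin

section \<open>Elementary properties of spectral measures\<close>

lemma spectral_scaleC: "\<delta> \<in> sets borel \<Longrightarrow> E \<delta> (a *\<^sub>C f) = a *\<^sub>C E \<delta> f"
  using spectral by (auto simp: spectral_measure_def)

lemma spectral_Int: "\<delta> \<in> sets borel \<Longrightarrow> \<sigma> \<in> sets borel \<Longrightarrow> E (\<delta> \<inter> \<sigma>) f = E \<delta> (E \<sigma> f)"
  using spectral by (auto simp: spectral_measure_def)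

lemma spectral_UNIV [simp]: "E UNIV f = f"
  using spectral by (auto simp: spectral_measure_def)

lemma spectral_sums:
  "range \<delta> \<subseteq> sets borel \<Longrightarrow> disjoint_family \<delta> \<Longrightarrow>
     (\<lambda>n :: nat. E (\<delta> n) f) sums E (\<Union>n. \<delta> n) f"
  using spectral by (auto simp: spectral_measure_def)

text \<open>Empty sets form a disjoint sequence, and a constant series converges only if its term is
  zero.\<close>

lemma spectral_empty [simp]: "E {} f = 0"
proof -
  have "(\<lambda>n :: nat. E {} f) sums E {} f"
    using spectral_sums[of "\<lambda>_. {}" f] by (simp add: disjoint_family_on_def)
  then show ?thesis
    using summable_LIMSEQ_zero[OF sums_summable] LIMSEQ_const_iff by blast
qed

lemma spectral_Un:
  assumes "A \<in> sets borel" "B \<in> sets borel" "A \<inter> B = {}"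
  shows "E (A \<union> B) f = E A f + E B f"
proof -
  have "(\<lambda>n. E (binaryset A B n) f) sums E (\<Union>n. binaryset A B n) f"
    by (rule spectral_sums)
      (use assms in \<open>auto simp: range_binaryset_eq disjoint_family_on_def binaryset_def\<close>)
  moreover have "(\<lambda>n. E (binaryset A B n) f) sums (E A f + E B f)"
    using binaryset_sums[of "\<lambda>A. E A f"] by simp
  ultimately show ?thesis
    by (metis UN_binaryset_eq sums_unique2)
qed

lemma spectral_Union_finite:
  assumes "finite I" "\<And>i. i \<in> I \<Longrightarrow> A i \<in> sets borel" "disjoint_family_on A I"
  shows "E (\<Union>i\<in>I. A i) f = (\<Sum>i\<in>I. E (A i) f)"
  using assms
proof (induction I rule: finite_induct)
  case (insert i I)
  have "E (A i \<union> (\<Union>i\<in>I. A i)) f = E (A i) f + E (\<Union>i\<in>I. A i) f"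
    using insert by (intro spectral_Un) (auto simp: disjoint_family_on_def intro!: sets.finite_UN)
  then show ?case
    using insert by (simp add: disjoint_family_on_insert)
qed simp

text \<open>Vanishing of \<open>E (A i) f\<close> passes to Borel subsets by multiplicativity, so
  the union can be made disjoint before countable additivity is applied.\<close>

lemma spectral_null_UN:
  assumes "\<And>i :: nat. A i \<in> sets borel" "\<And>i. E (A i) f = 0"
  shows "E (\<Union>i. A i) f = 0"
proof -
  have D: "disjointed A i \<in> sets borel" for i
    using sets.range_disjointed_sets[of A borel] assms(1) by blast
  have "E (disjointed A i) f = E (disjointed A i) (E (A i) f)" for i
    using spectral_Int[OF D[of i] assms(1)[of i], of f] disjointed_subset[of A i]
    by (simp add: Int_absorb2)
  then have "E (disjointed A i) f = 0" for i
    by (simp add: assms(2) blinfun.zero_right)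
  moreover have "(\<lambda>i. E (disjointed A i) f) sums E (\<Union>i. disjointed A i) f"
    using D by (intro spectral_sums disjoint_family_disjointed) auto
  ultimately show ?thesis
    using sums_unique2[OF sums_zero] by (simp add: UN_disjointed_eq)
qed

text \<open>Idempotence turns membership in a spectral subspace into a fixed point equation, the
  form used in the estimates below.\<close>

lemma range_spectral_iff:
  assumes "\<delta> \<in> sets borel"
  shows "f \<in> range (E \<delta>) \<longleftrightarrow> E \<delta> f = f"
  using spectral_Int[OF assms assms] by (auto intro: range_eqI[OF sym])

lemma spectral_eq_self_iff:
  assumes "\<delta> \<in> sets borel"
  shows "E \<delta> f = f \<longleftrightarrow> E (- \<delta>) f = 0"
proof -
  have "f = E \<delta> f + E (- \<delta>) f"
    using spectral_Un[of \<delta> "- \<delta>" f] assms by (simp add: Compl_partition)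
  then show ?thesis by (metis add_cancel_left_right)
qed

lemma spectral_measure_bounded: "\<exists>K. \<forall>\<delta>\<in>sets borel. norm (E \<delta>) \<le> K"
proof -
  have "\<exists>K. \<forall>\<delta>\<in>sets borel. norm (E \<delta> f) \<le> K" for f
  proof (rule countably_additive_bounded)
    show "E A f = E (A \<inter> B) f + E (A - B) f" if "A \<in> sets borel" "B \<in> sets borel" for A B
      using spectral_Un[of "A \<inter> B" "A - B" f] that by (simp add: Int_Diff_Un Int_Diff_disjoint)
  qed (rule spectral_sums)
  then have "\<exists>K. \<forall>T\<in>E ` sets borel. norm T \<le> K"
    by (intro uniform_boundedness) simp
  then show ?thesis by simp
qed

text \<open>
  With \<open>h z = (s z, t z)\<close> this evaluates two simple integrals on a common partition.
\<close>

lemma simple_integral_op_compose: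
  assumes "simple_function borel h"
  shows "simple_integral_op E (\<lambda>z. \<phi> (h z)) f = (\<Sum>b\<in>range h. \<phi> b *\<^sub>C E (h -` {b}) f)"
proof -
  have fin: "finite (range h)" and meas: "h -` {b} \<in> sets borel" for b
    using simple_functionD[OF assms] by auto
  have "simple_integral_op E (\<lambda>z. \<phi> (h z)) f =
      (\<Sum>w\<in>\<phi> ` range h. w *\<^sub>C E ((\<lambda>z. \<phi> (h z)) -` {w}) f)"
    by (simp add: simple_integral_op_def blinfun.sum_left image_image)
  also have "\<dots> = (\<Sum>w\<in>\<phi> ` range h. \<Sum>b | b \<in> range h \<and> \<phi> b = w. \<phi> b *\<^sub>C E (h -` {b}) f)"
  proof (rule sum.cong[OF refl])
    fix w
    have "(\<lambda>z. \<phi> (h z)) -` {w} = (\<Union>b\<in>{b \<in> range h. \<phi> b = w}. h -` {b})"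
      by auto
    then have "E ((\<lambda>z. \<phi> (h z)) -` {w}) f = (\<Sum>b | b \<in> range h \<and> \<phi> b = w. E (h -` {b}) f)"
      using fin meas by (simp add: spectral_Union_finite disjoint_family_on_def vimage_def disjoint_iff)
    then show "w *\<^sub>C E ((\<lambda>z. \<phi> (h z)) -` {w}) f =
        (\<Sum>b | b \<in> range h \<and> \<phi> b = w. \<phi> b *\<^sub>C E (h -` {b}) f)"
      by (simp add: scaleC_sum_right)
  qed
  also have "\<dots> = (\<Sum>b\<in>range h. \<phi> b *\<^sub>C E (h -` {b}) f)"
    by (rule sum.image_gen[OF fin, symmetric])
  finally show ?thesis .
qed

lemma simple_integral_op_diff:
  assumes "simple_function borel s" "simple_function borel t"
  shows "simple_integral_op E (\<lambda>z. s z - t z) = simple_integral_op E s - simple_integral_op E t"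
proof (rule blinfun_eqI)
  fix f
  let ?h = "\<lambda>z. (s z, t z)"
  note * = simple_integral_op_compose[OF simple_function_Pair[OF assms]]
  show "simple_integral_op E (\<lambda>z. s z - t z) f = (simple_integral_op E s - simple_integral_op E t) f"
    using *[of "\<lambda>p. fst p - snd p" f] *[of fst f] *[of snd f]
    by (simp add: blinfun.diff_left scaleC_diff_left sum_subtractf)
qed

text \<open>On the common partition given by \<open>h\<close>, projections of different cells
  annihilate each other, so the double sum collapses to its diagonal.\<close>

lemma simple_integral_op_mult:
  assumes "simple_function borel s" "simple_function borel t"
  shows "simple_integral_op E (\<lambda>z. s z * t z) = simple_integral_op E s o\<^sub>L simple_integral_op E t"
proof (rule blinfun_eqI)
  fix f
  define h where "h z = (s z, t z)" for z
  have h: "simple_function borel h"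
    unfolding h_def using assms by (rule simple_function_Pair)
  have fin: "finite (range h)" and meas: "h -` {b} \<in> sets borel" for b
    using simple_functionD[OF h] by auto
  have orth: "E (h -` {b}) (E (h -` {c}) f) = (if c = b then E (h -` {b}) f else 0)" for b c
  proof -
    have "h -` {b} \<inter> h -` {c} = (if c = b then h -` {b} else {})" by auto
    then show ?thesis
      using spectral_Int[OF meas[of b] meas[of c], of f] by (auto split: if_splits)
  qed
  note * = simple_integral_op_compose[OF h]
  have "simple_integral_op E s (simple_integral_op E t f) =
      (\<Sum>b\<in>range h. fst b *\<^sub>C (\<Sum>c\<in>range h. snd c *\<^sub>C E (h -` {b}) (E (h -` {c}) f)))"
    using *[of fst "simple_integral_op E t f"] *[of snd f]
    by (simp add: h_def[abs_def] blinfun.sum_right spectral_scaleC meas[unfolded h_def[abs_def]])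
  also have "\<dots> = (\<Sum>b\<in>range h. fst b *\<^sub>C (\<Sum>c\<in>range h. if c = b then snd b *\<^sub>C E (h -` {b}) f else 0))"
    unfolding orth by (intro sum.cong refl arg_cong2[where f = scaleC]) auto
  also have "\<dots> = (\<Sum>b\<in>range h. (fst b * snd b) *\<^sub>C E (h -` {b}) f)"
    using fin by (simp add: scaleC_scaleC)
  also have "\<dots> = simple_integral_op E (\<lambda>z. s z * t z) f"
    using *[of "\<lambda>p. fst p * snd p" f] by (simp add: h_def)
  finally show "simple_integral_op E (\<lambda>z. s z * t z) f =
      (simple_integral_op E s o\<^sub>L simple_integral_op E t) f"
    by simp
qed

lemma simple_integral_op_indicator:
  assumes "\<delta> \<in> sets borel"
  shows "simple_integral_op E (indicator \<delta>) = E \<delta>"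
proof (rule blinfun_eqI)
  fix f
  have fin: "finite (range (\<lambda>z. z \<in> \<delta>))" by (rule finite_subset[OF subset_UNIV]) simp
  have h: "simple_function borel (\<lambda>z. z \<in> \<delta>)"
    unfolding simple_function_def using fin assms by (auto simp: vimage_def Collect_neg_eq)
  have "simple_integral_op E (\<lambda>z. of_bool (z \<in> \<delta>)) f =
      (\<Sum>b\<in>range (\<lambda>z. z \<in> \<delta>). of_bool b *\<^sub>C E ((\<lambda>z. z \<in> \<delta>) -` {b}) f)"
    by (rule simple_integral_op_compose[OF h])
  \<comment> \<open>If \<open>\<delta>\<close> is empty or the whole plane, one truth value is not
    attained; its preimage is empty and adds zero.\<close>
  also have "\<dots> = (\<Sum>b\<in>UNIV. of_bool b *\<^sub>C E ((\<lambda>z. z \<in> \<delta>) -` {b}) f)"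
  proof (rule sum.mono_neutral_left)
    show "\<forall>b\<in>UNIV - range (\<lambda>z. z \<in> \<delta>). of_bool b *\<^sub>C E ((\<lambda>z. z \<in> \<delta>) -` {b}) f = 0"
    proof
      fix b assume "b \<in> UNIV - range (\<lambda>z. z \<in> \<delta>)"
      then have "(\<lambda>z. z \<in> \<delta>) -` {b} = {}" by auto
      then show "of_bool b *\<^sub>C E ((\<lambda>z. z \<in> \<delta>) -` {b}) f = 0"
        by simp
    qed
  qed simp_all
  also have "\<dots> = E \<delta> f"
    by (simp add: UNIV_bool scaleC_one vimage_def)
  finally show "simple_integral_op E (indicator \<delta>) f = E \<delta> f"
    by (simp add: indicator_def[abs_def] of_bool_def)
qed

text \<open>By additivity each subset sum is \<open>E\<close> of a preimage applied to
  \<open>f\<close>, so the uniform bound on \<open>E\<close> feeds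
  \<open>norm_sum_scaleC_le\<close>. The constant is the same for all simple functions.\<close>

lemma norm_simple_integral_op_le:
  "\<exists>C>0. \<forall>s L. simple_function borel s \<longrightarrow> L > 0 \<longrightarrow> (\<forall>z. cmod (s z) \<le> L) \<longrightarrow>
     norm (simple_integral_op E s) \<le> C * L"
proof -
  obtain K where K: "\<And>\<delta>. \<delta> \<in> sets borel \<Longrightarrow> norm (E \<delta>) \<le> K"
    using spectral_measure_bounded by blast
  have "K \<ge> 0"
    using K[of UNIV] norm_ge_zero[of "E UNIV"] by (simp del: norm_ge_zero)
  \<comment> \<open>Using \<open>K + 1\<close> keeps the constant positive even if \<open>K\<close>
    is zero.\<close>
  have "norm (simple_integral_op E s) \<le> 6 * (K + 1) * L"
    if s: "simple_function borel s" and "L > 0" and L: "\<And>z. cmod (s z) \<le> L" for s L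
  proof (rule norm_blinfun_bound)
    show "0 \<le> 6 * (K + 1) * L" using \<open>L > 0\<close> \<open>K \<ge> 0\<close> by simp
    fix f
    have fin: "finite (range s)" and meas: "s -` W \<in> sets borel" for W
      using simple_functionD[OF s] by auto
    have "norm (\<Sum>w\<in>range s. w *\<^sub>C E (s -` {w}) f) \<le> 6 * L * ((K + 1) * norm f)"
    proof (rule norm_sum_scaleC_le)
      fix S assume S: "S \<subseteq> range s"
      have "E (\<Union>w\<in>S. s -` {w}) f = (\<Sum>w\<in>S. E (s -` {w}) f)"
        using finite_subset[OF S fin] meas
        by (intro spectral_Union_finite) (auto simp: disjoint_family_on_def)
      then have "norm (\<Sum>w\<in>S. E (s -` {w}) f) = norm (E (s -` S) f)"
        by (simp flip: vimage_eq_UN)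
      also have "\<dots> \<le> K * norm f"
        using norm_blinfun[of "E (s -` S)" f] K[OF meas[of S]]
        by (meson mult_right_mono norm_ge_zero order_trans)
      also have "\<dots> \<le> (K + 1) * norm f"
        by (simp add: mult_right_mono)
      finally show "norm (\<Sum>w\<in>S. E (s -` {w}) f) \<le> (K + 1) * norm f" .
    qed (use fin \<open>L > 0\<close> L in auto)
    then show "norm (simple_integral_op E s f) \<le> 6 * (K + 1) * L * norm f"
      using simple_integral_op_compose[OF s, of "\<lambda>w. w" f] by (simp add: mult_ac)
  qed
  then show ?thesis
    using \<open>K \<ge> 0\<close> by (intro exI[of _ "6 * (K + 1)"]) simp
qed

text \<open>Taking \<open>t = s\<close> shows that one approximating sequence has Cauchy integrals;
  taking different sequences shows that the limit does not depend on the choice.\<close>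

lemma simple_integral_op_close:
  assumes "\<And>n. simple_function borel (s n)" "uniform_limit UNIV s G sequentially"
    and "\<And>n. simple_function borel (t n)" "uniform_limit UNIV t G sequentially"
    and "e > 0"
  shows "\<exists>N. \<forall>m\<ge>N. \<forall>n\<ge>N. norm (simple_integral_op E (s m) - simple_integral_op E (t n)) < e"
proof -
  obtain C where "C > 0" and C: "\<And>s L. simple_function borel s \<Longrightarrow> L > 0 \<Longrightarrow>
      (\<And>z. cmod (s z) \<le> L) \<Longrightarrow> norm (simple_integral_op E s) \<le> C * L"
    using norm_simple_integral_op_le by blast
  \<comment> \<open>Two functions within \<open>d\<close> of \<open>G\<close> differ by at most
    \<open>2 * d\<close>, and \<open>C * (2 * d)\<close> is \<open>e / 2\<close>.\<close>
  define d where "d = e / (4 * C)"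
  have "d > 0" using \<open>C > 0\<close> \<open>e > 0\<close> by (simp add: d_def)
  have "\<forall>\<^sub>F n in sequentially. (\<forall>z. dist (s n z) (G z) < d) \<and> (\<forall>z. dist (t n z) (G z) < d)"
    using assms(2,4) \<open>d > 0\<close> by (auto simp: uniform_limit_iff intro: eventually_conj)
  then obtain N where N: "\<And>n z. n \<ge> N \<Longrightarrow> dist (s n z) (G z) < d"
      "\<And>n z. n \<ge> N \<Longrightarrow> dist (t n z) (G z) < d"
    unfolding eventually_sequentially by blast
  have "norm (simple_integral_op E (s m) - simple_integral_op E (t n)) < e"
    if "m \<ge> N" "n \<ge> N" for m n
  proof -
    have "cmod (s m z - t n z) \<le> 2 * d" for z
      using dist_triangle2[of "s m z" "t n z" "G z"] N(1)[OF that(1), of z] N(2)[OF that(2), of z]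
      by (simp add: dist_norm)
    then have "norm (simple_integral_op E (\<lambda>z. s m z - t n z)) \<le> C * (2 * d)"
      using \<open>d > 0\<close> assms(1,3) by (intro C) auto
    also have "\<dots> < e"
      using \<open>C > 0\<close> \<open>e > 0\<close> by (simp add: d_def)
    finally show ?thesis
      using assms(1,3) by (simp add: simple_integral_op_diff)
  qed
  then show ?thesis by blast
qed

text \<open>Justifies the definite description in \<open>bounded_integral_op\<close>: completeness
  of the operator space yields a limit, and any other admissible sequence has the same one.\<close>

lemma bounded_integral_op_LIMSEQ:
  assumes "\<And>n. simple_function borel (s n)" "uniform_limit UNIV s G sequentially"
  shows "(\<lambda>n. simple_integral_op E (s n)) \<longlonglongrightarrow> bounded_integral_op E G"
proof -
  have "Cauchy (\<lambda>n. simple_integral_op E (s n))"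
    unfolding Cauchy_def dist_norm using simple_integral_op_close[OF assms assms] by blast
  then obtain T where T: "(\<lambda>n. simple_integral_op E (s n)) \<longlonglongrightarrow> T"
    using Cauchy_convergent_iff convergent_def by blast
  moreover have "bounded_integral_op E G = T"
    unfolding bounded_integral_op_def
  proof (rule the_equality)
    fix U assume "\<exists>t. (\<forall>n. simple_function borel (t n)) \<and> uniform_limit UNIV t G sequentially \<and>
        (\<lambda>n. simple_integral_op E (t n)) \<longlonglongrightarrow> U"
    then obtain t where t: "\<And>n. simple_function borel (t n)" "uniform_limit UNIV t G sequentially"
      and U: "(\<lambda>n. simple_integral_op E (t n)) \<longlonglongrightarrow> U" by blast
    have "(\<lambda>n. simple_integral_op E (t n) - simple_integral_op E (s n)) \<longlonglongrightarrow> 0"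
      using simple_integral_op_close[OF t assms] by (intro LIMSEQ_I) fastforce
    then show "U = T"
      using tendsto_diff[OF U T] LIMSEQ_unique by fastforce
  qed (use T assms in blast)
  ultimately show ?thesis by simp
qed

lemma bounded_integral_op_indicator:
  assumes "\<delta> \<in> sets borel"
  shows "bounded_integral_op E (indicator \<delta>) = E \<delta>"
proof -
  have "simple_function borel (indicator \<delta> :: complex \<Rightarrow> complex)"
    using assms by simp
  moreover have "uniform_limit UNIV (\<lambda>_ :: nat. indicator \<delta> :: complex \<Rightarrow> complex) (indicator \<delta>) sequentially"
    by (simp add: uniform_limit_iff)
  ultimately have "(\<lambda>_ :: nat. simple_integral_op E (indicator \<delta>)) \<longlonglongrightarrow> bounded_integral_op E (indicator \<delta>)"
    by (rule bounded_integral_op_LIMSEQ)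
  then show ?thesis
    by (simp add: simple_integral_op_indicator[OF assms] LIMSEQ_const_iff)
qed

text \<open>Multiplicativity passes from simple functions to the limit; boundedness of
  \<open>F\<close> and \<open>G\<close> makes the products of the approximants converge
  uniformly.\<close>

lemma bounded_integral_op_mult:
  assumes "F \<in> borel_measurable borel" "\<And>z. cmod (F z) \<le> K"
    and "G \<in> borel_measurable borel" "\<And>z. cmod (G z) \<le> L"
  shows "bounded_integral_op E (\<lambda>z. F z * G z) f = bounded_integral_op E F (bounded_integral_op E G f)"
proof -
  obtain s where s: "\<And>n :: nat. simple_function borel (s n)" "uniform_limit UNIV s F sequentially"
    using bounded_borel_uniform_approximation[OF assms(1,2)] by blast
  obtain t where t: "\<And>n :: nat. simple_function borel (t n)" "uniform_limit UNIV t G sequentially"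
    using bounded_borel_uniform_approximation[OF assms(3,4)] by blast
  have "uniform_limit UNIV (\<lambda>n z. s n z * t n z) (\<lambda>z. F z * G z) sequentially"
    using s(2) t(2)
    by (rule uniform_lim_mult) (use assms(2,4) in \<open>auto simp: bounded_iff\<close>)
  then have "(\<lambda>n. simple_integral_op E (\<lambda>z. s n z * t n z)) \<longlonglongrightarrow> bounded_integral_op E (\<lambda>z. F z * G z)"
    using s(1) t(1) by (intro bounded_integral_op_LIMSEQ) auto
  moreover have "(\<lambda>n. simple_integral_op E (s n) o\<^sub>L simple_integral_op E (t n))
      \<longlonglongrightarrow> (bounded_integral_op E F o\<^sub>L bounded_integral_op E G)"
    by (intro bounded_bilinear.tendsto[OF bounded_bilinear_blinfun_compose] bounded_integral_op_LIMSEQ s t)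
  ultimately have "bounded_integral_op E (\<lambda>z. F z * G z) = bounded_integral_op E F o\<^sub>L bounded_integral_op E G"
    using s(1) t(1) by (simp add: simple_integral_op_mult LIMSEQ_unique)
  then show ?thesis by simp
qed

text \<open>Approximants within \<open>L\<close> of \<open>G\<close> are bounded by
  \<open>2 * L\<close>, which doubles the constant for simple functions.\<close>

lemma norm_bounded_integral_op_le:
  "\<exists>C>0. \<forall>G L f. G \<in> borel_measurable borel \<longrightarrow> L > 0 \<longrightarrow> (\<forall>z. cmod (G z) \<le> L) \<longrightarrow>
     norm (bounded_integral_op E G f) \<le> C * L * norm f"
proof -
  obtain C where "C > 0" and C: "\<And>s L. simple_function borel s \<Longrightarrow> L > 0 \<Longrightarrow>
      (\<And>z. cmod (s z) \<le> L) \<Longrightarrow> norm (simple_integral_op E s) \<le> C * L"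
    using norm_simple_integral_op_le by blast
  have "norm (bounded_integral_op E G f) \<le> (2 * C) * L * norm f"
    if G: "G \<in> borel_measurable borel" "\<And>z. cmod (G z) \<le> L" and "L > 0" for G L f
  proof -
    obtain s where s: "\<And>n :: nat. simple_function borel (s n)" "uniform_limit UNIV s G sequentially"
      using bounded_borel_uniform_approximation[OF G] by blast
    have "\<forall>\<^sub>F n in sequentially. \<forall>z. dist (s n z) (G z) < L"
      using s(2) \<open>L > 0\<close> by (auto simp: uniform_limit_iff)
    then have "\<forall>\<^sub>F n in sequentially. norm (simple_integral_op E (s n)) \<le> C * (2 * L)"
    proof eventually_elim
      case (elim n)
      have "cmod (s n z) \<le> 2 * L" for z
        using norm_triangle_sub[of "s n z" "G z"] G(2)[of z] elim[rule_format, of z] by (simp add: dist_norm)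
      then show ?case using s(1) \<open>L > 0\<close> by (intro C) auto
    qed
    then have "norm (bounded_integral_op E G) \<le> C * (2 * L)"
      by (intro tendsto_upperbound[OF tendsto_norm[OF bounded_integral_op_LIMSEQ[OF s]]]) auto
    then have "norm (bounded_integral_op E G) * norm f \<le> C * (2 * L) * norm f"
      by (rule mult_right_mono) simp
    then show ?thesis
      using norm_blinfun[of "bounded_integral_op E G" f] by (simp add: mult_ac)
  qed
  then show ?thesis using \<open>C > 0\<close> by (intro exI[of _ "2 * C"]) simp
qed

end


section \<open>Exponential type and spectral subspaces\<close>

text \<open>One family covers all integrands needed: \<open>k = 0\<close> gives the indicator,
  \<open>k = 1\<close> on a disc the truncated identity, and general \<open>k\<close> the powers of
  the operator.\<close>

definition cut_power :: "complex set \<Rightarrow> nat \<Rightarrow> complex \<Rightarrow> complex" where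
  "cut_power \<delta> k z = indicator \<delta> z * z ^ k"

lemma cut_power_measurable [measurable]:
  assumes [measurable]: "\<delta> \<in> sets borel"
  shows "cut_power \<delta> k \<in> borel_measurable borel"
proof -
  have [measurable]: "(\<lambda>z :: complex. z ^ k) \<in> borel_measurable borel"
    by (intro borel_measurable_continuous_onI continuous_intros)
  show ?thesis
    unfolding cut_power_def[abs_def] by measurable
qed

lemma norm_cut_power_le:
  assumes "\<delta> \<subseteq> \<Delta> r" "r \<ge> 0"
  shows "cmod (cut_power \<delta> k z) \<le> r ^ k"
  using assms by (auto simp: cut_power_def closed_disc_def indicator_def norm_mult norm_power
      intro!: power_mono)

lemma closed_disc_borel [measurable]: "\<Delta> r \<in> sets borel"
  unfolding closed_disc_def by measurable

lemma truncation_id_eq: "truncation (\<lambda>z. z) n = cut_power (\<Delta> (real n)) 1"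
  by (auto simp: truncation_def cut_power_def closed_disc_def)

abbreviation cut_integral ::
    "(complex set \<Rightarrow> 'a \<Rightarrow>\<^sub>L 'a :: complex_banach) \<Rightarrow> complex set \<Rightarrow> nat \<Rightarrow> 'a \<Rightarrow>\<^sub>L 'a" where
  "cut_integral E \<delta> k \<equiv> bounded_integral_op E (cut_power \<delta> k)"

context
  fixes E :: "complex set \<Rightarrow> 'a \<Rightarrow>\<^sub>L 'a :: complex_banach" and A :: "'a \<rightharpoonup> 'a"
  assumes measure_of: "is_spectral_measure_of E A"
begin

section \<open>The operator and its powers on spectral subspaces\<close>

lemma spectral_measure_of: "spectral_measure E" and A_eq: "A = spectral_integral E (\<lambda>z. z)"
  using measure_of by (auto simp: is_spectral_measure_of_def)

lemma range_disc_iff: "f \<in> range (E (\<Delta> \<alpha>)) \<longleftrightarrow> E (\<Delta> \<alpha>) f = f"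
  by (rule range_spectral_iff[OF spectral_measure_of closed_disc_borel])

lemma cut_integral_0: "\<delta> \<in> sets borel \<Longrightarrow> cut_integral E \<delta> 0 = E \<delta>"
  using bounded_integral_op_indicator[OF spectral_measure_of] by (simp add: cut_power_def[abs_def])

text \<open>Exponents add and sets intersect because the bounded calculus is multiplicative; the
  enclosing discs supply the bounds it requires.\<close>

lemma cut_integral_mult:
  assumes [measurable]: "\<delta> \<in> sets borel" "\<sigma> \<in> sets borel" and "\<delta> \<subseteq> \<Delta> r" "\<sigma> \<subseteq> \<Delta> s" "r \<ge> 0" "s \<ge> 0"
  shows "cut_integral E \<delta> j (cut_integral E \<sigma> k f) = cut_integral E (\<delta> \<inter> \<sigma>) (j + k) f"
proof -
  have "cut_power (\<delta> \<inter> \<sigma>) (j + k) = (\<lambda>z. cut_power \<delta> j z * cut_power \<sigma> k z)"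
    by (auto simp: cut_power_def indicator_def power_add)
  moreover have "bounded_integral_op E (\<lambda>z. cut_power \<delta> j z * cut_power \<sigma> k z) f =
      cut_integral E \<delta> j (cut_integral E \<sigma> k f)"
    by (rule bounded_integral_op_mult[OF spectral_measure_of _ norm_cut_power_le[OF assms(3,5)] _ norm_cut_power_le[OF assms(4,6)]])
      simp_all
  ultimately show ?thesis by simp
qed

text \<open>Packs domain and value of \<open>A\<close> into one limit, since truncating the identity
  at level \<open>n\<close> is cutting it off to the disc of radius \<open>n\<close>.\<close>

lemma operator_Some_iff:
  "A f = Some u \<longleftrightarrow> (\<lambda>n. cut_integral E (\<Delta> (real n)) 1 f) \<longlonglongrightarrow> u"
proof -
  have "lim (\<lambda>n. cut_integral E (\<Delta> (real n)) 1 f) = u"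
    if "(\<lambda>n. cut_integral E (\<Delta> (real n)) 1 f) \<longlonglongrightarrow> u"
    using that by (rule limI)
  then show ?thesis
    unfolding A_eq spectral_integral_def truncation_id_eq
    by (metis convergent_LIMSEQ_iff convergent_def option.distinct(1) option.inject)
qed

text \<open>Once \<open>n\<close> is at least \<open>\<alpha>\<close>, the disc of radius
  \<open>n\<close> cuts nothing off, so the sequence defining the next power is eventually
  constant.\<close>

lemma op_power_disc:
  assumes f: "E (\<Delta> \<alpha>) f = f" and "\<alpha> > 0"
  shows "op_power A k f = Some (cut_integral E (\<Delta> \<alpha>) k f)"
proof (induction k)
  case 0
  then show ?case using f by (simp add: cut_integral_0)
next
  case (Suc k)
  have "(\<lambda>n. cut_integral E (\<Delta> (real n)) 1 (cut_integral E (\<Delta> \<alpha>) k f)) \<longlonglongrightarrow> cut_integral E (\<Delta> \<alpha>) (Suc k) f"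
  proof (rule tendsto_eventually, rule eventually_mono)
    show "\<forall>\<^sub>F n in sequentially. \<alpha> \<le> real n"
      using eventually_ge_at_top[of "nat \<lceil>\<alpha>\<rceil>"] by eventually_elim linarith
    fix n assume "\<alpha> \<le> real n"
    then have "\<Delta> (real n) \<inter> \<Delta> \<alpha> = \<Delta> \<alpha>" by (auto simp: closed_disc_def)
    then show "cut_integral E (\<Delta> (real n)) 1 (cut_integral E (\<Delta> \<alpha>) k f) = cut_integral E (\<Delta> \<alpha>) (Suc k) f"
      using cut_integral_mult[of "\<Delta> (real n)" "\<Delta> \<alpha>" "real n" \<alpha> 1 k f] \<open>\<alpha> > 0\<close> by simp
  qed
  then show ?case
    using Suc by (simp add: operator_Some_iff[THEN iffD2] map_comp_def)
qed

lemma disc_imp_C_infinity: "E (\<Delta> \<alpha>) f = f \<Longrightarrow> \<alpha> > 0 \<Longrightarrow> f \<in> C_infinity A"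
  by (simp add: C_infinity_def op_power_disc domI)

text \<open>The constant may depend on \<open>f\<close> but not on \<open>\<alpha>\<close>, so
  \<open>\<alpha>\<close> can later tend to zero.\<close>

lemma norm_op_power_disc_le:
  obtains C where "C > 0" "\<And>\<alpha> k. \<alpha> > 0 \<Longrightarrow> E (\<Delta> \<alpha>) f = f \<Longrightarrow> norm (the (op_power A k f)) \<le> C * \<alpha> ^ k"
proof -
  obtain C where C: "C > 0" "\<And>G L f. G \<in> borel_measurable borel \<Longrightarrow> L > 0 \<Longrightarrow>
      (\<And>z. cmod (G z) \<le> L) \<Longrightarrow> norm (bounded_integral_op E G f) \<le> C * L * norm f"
    using norm_bounded_integral_op_le[OF spectral_measure_of] by blast
  show thesis
  proof
    show "C * norm f + 1 > 0" using C(1) by (simp add: add_nonneg_pos)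
    fix \<alpha> :: real and k assume "\<alpha> > 0" "E (\<Delta> \<alpha>) f = f"
    moreover have "norm (cut_integral E (\<Delta> \<alpha>) k f) \<le> C * \<alpha> ^ k * norm f"
      using norm_cut_power_le[of "\<Delta> \<alpha>" \<alpha> k] \<open>\<alpha> > 0\<close> by (intro C(2)) auto
    moreover have "C * \<alpha> ^ k * norm f \<le> (C * norm f + 1) * \<alpha> ^ k"
      using \<open>\<alpha> > 0\<close> by (simp add: algebra_simps)
    ultimately show "norm (the (op_power A k f)) \<le> (C * norm f + 1) * \<alpha> ^ k"
      by (simp only: op_power_disc option.sel)
  qed
qed

text \<open>The bounded operator \<open>E \<delta>\<close> passes through the limit defining
  \<open>A\<close>, and on a bounded set the truncations stabilize. Here \<open>f\<close> need not
  lie in a spectral subspace of a disc.\<close>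

lemma spectral_op_power:
  assumes [measurable]: "\<delta> \<in> sets borel" and "\<delta> \<subseteq> \<Delta> r" "r \<ge> 0" and "op_power A k f = Some u"
  shows "E \<delta> u = cut_integral E \<delta> k f"
  using assms(4)
proof (induction k arbitrary: u)
  case 0
  then show ?case by (simp add: cut_integral_0)
next
  case (Suc k)
  then obtain g where g: "op_power A k f = Some g" "A g = Some u"
    by (auto simp: map_comp_def split: option.splits)
  have "(\<lambda>n. E \<delta> (cut_integral E (\<Delta> (real n)) 1 g)) \<longlonglongrightarrow> E \<delta> u"
    using g(2) by (intro tendsto_intros) (simp add: operator_Some_iff)
  moreover have "(\<lambda>n. E \<delta> (cut_integral E (\<Delta> (real n)) 1 g)) \<longlonglongrightarrow> cut_integral E \<delta> 1 g"
  proof (rule tendsto_eventually, rule eventually_mono)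
    show "\<forall>\<^sub>F n in sequentially. r \<le> real n"
      using eventually_ge_at_top[of "nat \<lceil>r\<rceil>"] by eventually_elim linarith
    fix n assume "r \<le> real n"
    then have "\<delta> \<inter> \<Delta> (real n) = \<delta>" using assms(2) by (auto simp: closed_disc_def)
    then show "E \<delta> (cut_integral E (\<Delta> (real n)) 1 g) = cut_integral E \<delta> 1 g"
      using cut_integral_mult[of \<delta> "\<Delta> (real n)" r "real n" 0 1 g] assms by (simp add: cut_integral_0)
  qed
  ultimately have "E \<delta> u = cut_integral E \<delta> 1 g" by (rule LIMSEQ_unique)
  \<comment> \<open>A second copy of \<open>E \<delta>\<close> is inserted so that the induction
    hypothesis applies to \<open>g\<close>.\<close>
  also have "\<dots> = cut_integral E \<delta> 1 (E \<delta> g)"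
    using cut_integral_mult[of \<delta> \<delta> r r 1 0 g] assms by (simp add: cut_integral_0)
  also have "\<dots> = cut_integral E \<delta> (Suc k) f"
    using cut_integral_mult[of \<delta> \<delta> r r 1 k f] assms Suc.IH[OF g(1)] by simp
  finally show ?case .
qed

text \<open>Doubling the radius turns the growth bound into geometric decay with ratio 1/2 outside
  the disc.\<close>

lemma spectral_disc_eq_self:
  assumes "f \<in> C_infinity A" "\<alpha> > 0" "\<And>n. norm (the (op_power A n f)) \<le> c * \<alpha> ^ n"
  shows "E (\<Delta> (2 * \<alpha>)) f = f"
proof -
  obtain C where C: "C > 0" "\<And>G L f. G \<in> borel_measurable borel \<Longrightarrow> L > 0 \<Longrightarrow>
      (\<And>z. cmod (G z) \<le> L) \<Longrightarrow> norm (bounded_integral_op E G f) \<le> C * L * norm f"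
    using norm_bounded_integral_op_le[OF spectral_measure_of] by blast
  \<comment> \<open>Bounded annuli, so that cut powers are bounded on them; over all
    \<open>m\<close> they exhaust the complement of the disc.\<close>
  define \<sigma> where "\<sigma> m = \<Delta> (real m) - \<Delta> (2 * \<alpha>)" for m
  have [measurable]: "\<sigma> m \<in> sets borel" for m
    by (simp add: \<sigma>_def)
  have "E (\<sigma> m) f = 0" for m
  proof -
    have le: "norm (E (\<sigma> m) f) \<le> (C * norm (E (\<sigma> m)) * c) * (1 / 2) ^ k" for k
    proof -
      \<comment> \<open>Inverts the power on the annulus, where \<open>z\<close> is nonzero and
        \<open>G\<close> is bounded by \<open>inverse (2 * \<alpha>) ^ k\<close>.\<close>
      define G where "G z = indicator (\<sigma> m) z * inverse z ^ k" for z :: complex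
      have [measurable]: "G \<in> borel_measurable borel"
        unfolding G_def by measurable
      have G_le: "cmod (G z) \<le> inverse (2 * \<alpha>) ^ k" for z
        using \<open>\<alpha> > 0\<close> by (auto simp: G_def indicator_def \<sigma>_def closed_disc_def norm_mult norm_power
            norm_inverse simp del: inverse_mult_distrib intro!: power_mono le_imp_inverse_le)
      have "indicator (\<sigma> m) = (\<lambda>z. G z * cut_power (\<sigma> m) k z)"
      proof
        fix z
        have "z \<noteq> 0" if "z \<in> \<sigma> m" using that \<open>\<alpha> > 0\<close> by (auto simp: \<sigma>_def closed_disc_def)
        then show "indicator (\<sigma> m) z = G z * cut_power (\<sigma> m) k z"
          by (auto simp: G_def cut_power_def indicator_def power_mult_distrib[symmetric])
      qed
      then have "E (\<sigma> m) f = bounded_integral_op E (\<lambda>z. G z * cut_power (\<sigma> m) k z) f"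
        using bounded_integral_op_indicator[OF spectral_measure_of, of "\<sigma> m"] by simp
      also have "\<dots> = bounded_integral_op E G (cut_integral E (\<sigma> m) k f)"
        by (rule bounded_integral_op_mult[OF spectral_measure_of _ G_le _ norm_cut_power_le[of _ "real m"]])
          (auto simp: \<sigma>_def)
      also have "cut_integral E (\<sigma> m) k f = E (\<sigma> m) (the (op_power A k f))"
      proof (rule spectral_op_power[of _ "real m", symmetric])
        show "op_power A k f = Some (the (op_power A k f))"
          using assms(1) unfolding C_infinity_def by (metis INT_D UNIV_I domD option.sel)
      qed (auto simp: \<sigma>_def)
      finally have "norm (E (\<sigma> m) f) \<le>
          C * inverse (2 * \<alpha>) ^ k * norm (E (\<sigma> m) (the (op_power A k f)))"
        using C(2)[OF _ _ G_le] \<open>\<alpha> > 0\<close> by simp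
      also have "\<dots> \<le> C * inverse (2 * \<alpha>) ^ k * (norm (E (\<sigma> m)) * (c * \<alpha> ^ k))"
        using C(1) \<open>\<alpha> > 0\<close> assms(3)[of k]
        by (intro mult_left_mono order_trans[OF norm_blinfun]) auto
      also have "\<dots> = (C * norm (E (\<sigma> m)) * c) * (inverse (2 * \<alpha>) * \<alpha>) ^ k"
        by (simp add: power_mult_distrib del: inverse_mult_distrib)
      also have "inverse (2 * \<alpha>) * \<alpha> = 1 / 2"
        using \<open>\<alpha> > 0\<close> by (simp add: field_simps)
      finally show ?thesis .
    qed
    have "(\<lambda>k. (C * norm (E (\<sigma> m)) * c) * (1 / 2) ^ k) \<longlonglongrightarrow> 0"
      by (intro tendsto_mult_right_zero LIMSEQ_realpow_zero) auto
    then have "norm (E (\<sigma> m) f) \<le> 0"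
      using le by (intro LIMSEQ_le_const) auto
    then show ?thesis by simp
  qed
  then have "E (\<Union>m. \<sigma> m) f = 0"
    by (intro spectral_null_UN[OF spectral_measure_of]) auto
  also have "(\<Union>m. \<sigma> m) = - \<Delta> (2 * \<alpha>)"
    by (auto simp: \<sigma>_def closed_disc_def real_arch_simple)
  finally show ?thesis
    by (simp add: spectral_eq_self_iff[OF spectral_measure_of])
qed

section \<open>The two classes of vectors, the discs and the kernel\<close>

lemma exp_type_vectors_eq: "exp_type_vectors A = (\<Union>\<alpha>\<in>{0<..}. range (E (\<Delta> \<alpha>)))"
proof (intro set_eqI iffI)
  fix f assume "f \<in> exp_type_vectors A"
  then obtain \<alpha> c where "f \<in> C_infinity A" "\<alpha> > 0" "\<And>n. norm (the (op_power A n f)) \<le> c * \<alpha> ^ n"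
    by (auto simp: exp_type_vectors_def)
  \<comment> \<open>The loss of a factor 2 in the radius is absorbed by the union over all
    radii.\<close>
  then have "E (\<Delta> (2 * \<alpha>)) f = f" "2 * \<alpha> > 0"
    by (auto intro: spectral_disc_eq_self)
  then show "f \<in> (\<Union>\<alpha>\<in>{0<..}. range (E (\<Delta> \<alpha>)))"
    by (intro UN_I[of "2 * \<alpha>"]) (simp_all add: range_disc_iff)
next
  fix f assume "f \<in> (\<Union>\<alpha>\<in>{0<..}. range (E (\<Delta> \<alpha>)))"
  then obtain \<alpha> where \<alpha>: "\<alpha> > 0" "E (\<Delta> \<alpha>) f = f"
    by (auto simp only: UN_iff range_disc_iff greaterThan_iff)
  obtain C where C: "C > 0" "\<And>\<alpha> k. \<alpha> > 0 \<Longrightarrow> E (\<Delta> \<alpha>) f = f \<Longrightarrow> norm (the (op_power A k f)) \<le> C * \<alpha> ^ k"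
    by (rule norm_op_power_disc_le[of f]) (rule that)
  then have "\<forall>k. norm (the (op_power A k f)) \<le> C * \<alpha> ^ k"
    using \<alpha> by simp
  with C(1) \<alpha>(1) disc_imp_C_infinity[OF \<alpha>(2,1)] show "f \<in> exp_type_vectors A"
    unfolding exp_type_vectors_def by blast
qed

lemma min_exp_type_vectors_eq: "min_exp_type_vectors A = (\<Inter>\<alpha>\<in>{0<..}. range (E (\<Delta> \<alpha>)))"
proof (intro set_eqI iffI)
  fix f assume f: "f \<in> min_exp_type_vectors A"
  have "E (\<Delta> \<alpha>) f = f" if "\<alpha> > 0" for \<alpha>
  proof -
    \<comment> \<open>Half the radius, because \<open>spectral_disc_eq_self\<close> doubles
      it.\<close>
    have "\<alpha> / 2 > 0" using that by simp
    then obtain c where "\<forall>n. norm (the (op_power A n f)) \<le> c * (\<alpha> / 2) ^ n"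
      using f unfolding min_exp_type_vectors_def by blast
    then show ?thesis
      using spectral_disc_eq_self[of f "\<alpha> / 2" c] f that by (simp add: min_exp_type_vectors_def)
  qed
  then show "f \<in> (\<Inter>\<alpha>\<in>{0<..}. range (E (\<Delta> \<alpha>)))"
    by (simp add: range_disc_iff)
next
  fix f assume "f \<in> (\<Inter>\<alpha>\<in>{0<..}. range (E (\<Delta> \<alpha>)))"
  then have f: "E (\<Delta> \<alpha>) f = f" if "\<alpha> > 0" for \<alpha>
    using that by (simp add: range_disc_iff)
  obtain C where C: "C > 0" "\<And>\<alpha> k. \<alpha> > 0 \<Longrightarrow> E (\<Delta> \<alpha>) f = f \<Longrightarrow> norm (the (op_power A k f)) \<le> C * \<alpha> ^ k"
    by (rule norm_op_power_disc_le[of f]) (rule that)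
  then have "\<forall>\<alpha>>0. \<exists>c>0. \<forall>n. norm (the (op_power A n f)) \<le> c * \<alpha> ^ n"
    \<comment> \<open>The same \<open>C\<close> serves every \<open>\<alpha>\<close>.\<close>
    using f by (intro allI impI exI[of _ C]) simp
  with disc_imp_C_infinity[OF f[OF zero_less_one] zero_less_one] show "f \<in> min_exp_type_vectors A"
    unfolding min_exp_type_vectors_def by blast
qed

text \<open>The punctured plane is the countable union of the complements of the discs of radius
  1/(n+1), each null for \<open>f\<close>; conversely {0} lies in every disc.\<close>

lemma INT_range_disc_eq: "(\<Inter>\<alpha>\<in>{0<..}. range (E (\<Delta> \<alpha>))) = range (E {0})"
proof (intro set_eqI iffI)
  fix f assume "f \<in> (\<Inter>\<alpha>\<in>{0<..}. range (E (\<Delta> \<alpha>)))"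
  then have f: "E (\<Delta> \<alpha>) f = f" if "\<alpha> > 0" for \<alpha>
    using that by (simp add: range_disc_iff)
  have "E (- \<Delta> (inverse (real (Suc n)))) f = 0" for n
    by (rule spectral_eq_self_iff[THEN iffD1, OF spectral_measure_of closed_disc_borel f]) simp
  then have "E (\<Union>n. - \<Delta> (inverse (real (Suc n)))) f = 0"
    by (intro spectral_null_UN[OF spectral_measure_of]) auto
  also have "(\<Union>n. - \<Delta> (inverse (real (Suc n)))) = - {0}"
  proof -
    have "\<exists>n. inverse (real (Suc n)) < cmod z" if "z \<noteq> 0" for z
      using reals_Archimedean[of "cmod z"] that by simp
    then show ?thesis by (force simp: closed_disc_def not_le)
  qed
  finally show "f \<in> range (E {0})"
    by (simp add: range_spectral_iff[OF spectral_measure_of] spectral_eq_self_iff[OF spectral_measure_of])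
next
  fix f assume "f \<in> range (E {0})"
  then have "E {0} f = f" by (simp add: range_spectral_iff[OF spectral_measure_of])
  moreover have "\<Delta> \<alpha> \<inter> {0} = {0}" if "\<alpha> > 0" for \<alpha>
    using that by (auto simp: closed_disc_def)
  ultimately have "E (\<Delta> \<alpha>) f = f" if "\<alpha> > 0" for \<alpha>
    using spectral_Int[OF spectral_measure_of, of "\<Delta> \<alpha>" "{0}" f] that by simp
  then show "f \<in> (\<Inter>\<alpha>\<in>{0<..}. range (E (\<Delta> \<alpha>)))"
    by (simp add: range_disc_iff)
qed

text \<open>One way, the power estimate with exponent 1 holds for every radius and forces
  \<open>A f\<close> to vanish. The other way, a kernel vector has minimal exponential type, and the
  preceding equalities apply.\<close>

lemma range_spectral_singleton_eq_ker: "range (E {0}) = op_ker A"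
proof (intro set_eqI iffI)
  fix f assume "f \<in> range (E {0})"
  then have f: "E (\<Delta> \<alpha>) f = f" if "\<alpha> > 0" for \<alpha>
    using that unfolding INT_range_disc_eq[symmetric] by (simp add: range_disc_iff)
  obtain C where C: "C > 0" "\<And>\<alpha> k. \<alpha> > 0 \<Longrightarrow> E (\<Delta> \<alpha>) f = f \<Longrightarrow> norm (the (op_power A k f)) \<le> C * \<alpha> ^ k"
    by (rule norm_op_power_disc_le[of f]) (rule that)
  have "norm (the (A f)) \<le> C * \<alpha>" if "\<alpha> > 0" for \<alpha>
    using C(2)[OF that f[OF that], of 1] by (simp add: map_comp_def)
  \<comment> \<open>The radius is \<open>e / C\<close>.\<close>
  then have "norm (the (A f)) \<le> e" if "e > 0" for e
    using C(1) that by (metis divide_pos_pos nonzero_mult_div_cancel_left order_less_irrefl times_divide_eq_right)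
  then have "norm (the (A f)) \<le> 0"
    by (rule field_le_epsilon) simp
  moreover have "A f \<noteq> None"
    using op_power_disc[OF f[OF zero_less_one] zero_less_one, of 1] by (simp add: map_comp_def)
  ultimately show "f \<in> op_ker A" by (auto simp: op_ker_def)
next
  fix f assume "f \<in> op_ker A"
  then have Af: "A f = Some 0" by (auto simp: op_ker_def)
  have A0: "A 0 = Some 0"
    by (simp add: operator_Some_iff blinfun.zero_right)
  \<comment> \<open>Power zero returns \<open>f\<close> itself, which is why the constant below is
    \<open>norm f + 1\<close>; from the second power on \<open>A 0 = Some 0\<close> is used.\<close>
  have pow: "op_power A n f = Some (if n = 0 then f else 0)" for n
    by (induction n) (auto simp: map_comp_def Af A0)
  have "norm (the (op_power A n f)) \<le> (norm f + 1) * \<alpha> ^ n" if "\<alpha> > 0" for n \<alpha>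
    using that by (auto simp: pow)
  moreover have "norm f + 1 > 0" by (simp add: add_nonneg_pos)
  moreover have "f \<in> C_infinity A" by (auto simp: C_infinity_def pow)
  ultimately have "f \<in> min_exp_type_vectors A"
    unfolding min_exp_type_vectors_def by blast
  then show "f \<in> range (E {0})"
    by (simp add: min_exp_type_vectors_eq INT_range_disc_eq)
qed

end

theorem theorem5p1:
  fixes A :: "'a :: complex_banach \<rightharpoonup> 'a"
    and E :: "complex set \<Rightarrow> 'a \<Rightarrow>\<^sub>L 'a"
  assumes "scalar_type_spectral A"
    and "is_spectral_measure_of E A"
  shows "exp_type_vectors A = (\<Union>\<alpha>\<in>{0<..}. range (E (\<Delta> \<alpha>)))
     \<and> (min_exp_type_vectors A = (\<Inter>\<alpha>\<in>{0<..}. range (E (\<Delta> \<alpha>)))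
       \<and> (\<Inter>\<alpha>\<in>{0<..}. range (E (\<Delta> \<alpha>))) = range (E {0})
       \<and> range (E {0}) = op_ker A)"
  by (intro conjI exp_type_vectors_eq[OF assms(2)] min_exp_type_vectors_eq[OF assms(2)]
      INT_range_disc_eq[OF assms(2)] range_spectral_singleton_eq_ker[OF assms(2)])

end
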